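(* Let $\Lambda$ be the linear program $\max c^tx$ subject to $Ax\leq b$, $x\in\mathbb{R}^n_{\geq 0}$ (with $A\in\mathbb{R}^{m\times n}$, $b\in\mathbb{R}^m$, $c\in\mathbb{R}^n\setminus\{0\}$), let $G\leq S_n$ be a symmetry group of $\Lambda$ with orbits $O_1,\dots,O_k$ on the standard basis, and let $\mathrm{Sub}(\Lambda)$, $\mathrm{Ret}(\mathrm{Sub}(\Lambda))$ and $M_r$ be as in the context. Suppose $\mathrm{Sub}(\Lambda)$ has a solution. Then: (i) $\mathrm{Ret}(\mathrm{Sub}(\Lambda))$ has a solution; (ii) for any solution $y^\ast$ of $\mathrm{Ret}(\mathrm{Sub}(\Lambda))$, the point $x^\ast_{\mathrm{fix}}:=M_ry^\ast$ is a solution of $\mathrm{Sub}(\Lambda)$.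
   Context: $S_n$ acts linearly on $\mathbb{R}^n$ by permuting the standard basis: $e_i^g=e_{i^g}$, extended linearly; $x^g$ denotes the image of $x$. For $\tau\in S_r$, $P_\tau$ is the corresponding permutation matrix and $v^\tau$ the correspondingly permuted vector $v\in\mathbb{R}^r$. A symmetry of $\Lambda$ is a $g\in S_n$ with $c^g=c$ such that there exists $\sigma\in S_m$ with $b^\sigma=b$ and $P_\sigma AP_g=A$; a symmetry group of $\Lambda$ is a subgroup of $S_n$ consisting of symmetries of $\Lambda$. $\mathrm{Fix}_G(\mathbb{R}^n)=\{y\in\mathbb{R}^n\mid y^g=y\text{ for all }g\in G\}$. Let $r_i$ be the smallest index with $e_{r_i}\in O_i$ and $v_i=\sum_{e_j\in O_i}e_j$. Define $P\in\mathbb{R}^{n\times n}$ by $Pe_{r_i}=v_i$ ($i=1,\dots,k$) and $Pe_l=0$ for $l\notin\{r_1,\dots,r_k\}$; set $\hat c^t=c^tP$, $\hat A=AP$. $\mathrm{Sub}(\Lambda)$ is the linear program $\max\hat c^tx$ s.t. $\hat Ax\leq b$, $Px\in\mathbb{R}^n_{\geq0}$, $x\in\mathrm{Fix}_G(\mathbb{R}^n)$. $M_r\in\mathbb{R}^{n\times k}$ is the matrix with columns $v_1,\dots,v_k$. $\mathrm{Ret}(\mathrm{Sub}(\Lambda))$ is the linear program in $y\in\mathbb{R}^k$: $\max\hat c^tM_ry$ s.t. $\hat AM_ry\leq b$, $y\in\mathbb{R}^k_{\geq0}$. A solution of a linear program is a feasible point maximizing its utility function. *)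

theory Defs
  imports "HOL-Analysis.Analysis" "HOL-Algebra.Group_Action"
begin

text \<open>
  The index set \<open>{1, \<dots>, n}\<close> is a finite linearly ordered type \<open>'n\<close>, so that the symmetric
  group is \<open>BijGroup (UNIV :: 'n set)\<close> and \<open>real ^ 'n\<close> carries the componentwise order.
\<close>

definition perm_act :: "('n::finite \<Rightarrow> 'n) \<Rightarrow> real ^ 'n \<Rightarrow> real ^ 'n" where
  "perm_act g x = (\<Sum>i\<in>UNIV. (x $ i) *\<^sub>R axis (g i) 1)"

definition perm_matrix :: "('n::finite \<Rightarrow> 'n) \<Rightarrow> real ^ 'n ^ 'n" where
  "perm_matrix g = matrix (perm_act g)"

text \<open>An abstract linear program is given by its utility function and its set of feasible points.\<close>

type_synonym 'a lp = "('a \<Rightarrow> real) \<times> 'a set"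

definition lp_solution :: "'a lp \<Rightarrow> 'a \<Rightarrow> bool" where
  "lp_solution L x \<longleftrightarrow> x \<in> snd L \<and> (\<forall>y\<in>snd L. fst L y \<le> fst L x)"

text \<open>
  From here on the program \<open>max c\<^sup>t x\<close> subject to \<open>A x \<le> b\<close>, \<open>x \<ge> 0\<close> is represented by its data
  \<open>A\<close>, \<open>b\<close>, \<open>c\<close>, on which its symmetries depend.
\<close>

definition lp_symmetry ::
  "real ^ 'n ^ 'm \<Rightarrow> real ^ 'm \<Rightarrow> real ^ 'n \<Rightarrow> ('n::finite \<Rightarrow> 'n) \<Rightarrow> bool" where
  "lp_symmetry A b c g \<longleftrightarrow>
     g \<in> carrier (BijGroup UNIV) \<and> perm_act g c = c \<and>
     (\<exists>\<sigma>\<in>carrier (BijGroup UNIV).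
        perm_act \<sigma> b = b \<and> perm_matrix \<sigma> ** A ** perm_matrix g = A)"

definition lp_symmetry_group ::
  "real ^ 'n ^ 'm \<Rightarrow> real ^ 'm \<Rightarrow> real ^ 'n \<Rightarrow> ('n::finite \<Rightarrow> 'n) set \<Rightarrow> bool" where
  "lp_symmetry_group A b c G \<longleftrightarrow>
     subgroup G (BijGroup UNIV) \<and> (\<forall>g\<in>G. lp_symmetry A b c g)"

definition Fix :: "('n::finite \<Rightarrow> 'n) set \<Rightarrow> (real ^ 'n) set" where
  "Fix G = {y. \<forall>g\<in>G. perm_act g y = y}"

definition basis_orbits :: "('n::finite \<Rightarrow> 'n) set \<Rightarrow> (real ^ 'n) set set" where
  "basis_orbits G =
     orbits (BijGroup UNIV\<lparr>carrier := G\<rparr>) (range (\<lambda>i. axis i 1)) perm_act"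

text \<open>
  Below, \<open>Orb :: 'k \<Rightarrow> _\<close> is an enumeration of the orbits on the standard basis, indexed by a
  finite type whose cardinality is the number of orbits.
\<close>

definition orb_rep :: "('k \<Rightarrow> (real ^ 'n::{finite,linorder}) set) \<Rightarrow> 'k \<Rightarrow> 'n" where
  "orb_rep Orb i = Min {j. axis j 1 \<in> Orb i}"

definition orb_vec :: "('k \<Rightarrow> (real ^ 'n) set) \<Rightarrow> 'k \<Rightarrow> real ^ 'n::finite" where
  "orb_vec Orb i = (\<Sum>j | axis j 1 \<in> Orb i. axis j 1)"

text \<open>
  Column \<open>l\<close> of the matrix is the image of \<open>e\<^sub>l\<close>. Orbit representatives are pairwise distinct,
  so \<open>inv_into UNIV\<close> recovers the orbit of a representative.
\<close>

definition orb_P ::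
  "('k \<Rightarrow> (real ^ 'n::{finite,linorder}) set) \<Rightarrow> real ^ 'n::{finite,linorder} ^ 'n::{finite,linorder}" where
  "orb_P Orb =
     (\<chi> a l. if l \<in> range (orb_rep Orb)
            then orb_vec Orb (inv_into UNIV (orb_rep Orb) l) $ a
            else 0)"

lemma orb_P_rep: "inj (orb_rep Orb) \<Longrightarrow> orb_P Orb *v axis (orb_rep Orb i) 1 = orb_vec Orb i"
  by (simp add: matrix_vector_mult_basis column_def orb_P_def vec_eq_iff)

lemma orb_P_nonrep: "l \<notin> range (orb_rep Orb) \<Longrightarrow> orb_P Orb *v axis l 1 = 0"
  by (simp add: matrix_vector_mult_basis column_def orb_P_def vec_eq_iff)

definition orb_M :: "('k \<Rightarrow> (real ^ 'n) set) \<Rightarrow> real ^ 'k ^ 'n::finite" where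
  "orb_M Orb = (\<chi> a i. orb_vec Orb i $ a)"

definition lp_Sub ::
  "real ^ 'n::{finite,linorder} ^ 'm \<Rightarrow> real ^ 'm \<Rightarrow> real ^ 'n::{finite,linorder} \<Rightarrow>
   ('n \<Rightarrow> 'n) set \<Rightarrow> ('k \<Rightarrow> (real ^ 'n::{finite,linorder}) set) \<Rightarrow>
   (real ^ 'n::{finite,linorder}) lp" where
  "lp_Sub A b c G Orb =
     (let P = orb_P Orb; c' = c v* P; A' = A ** P
      in (\<lambda>x. c' \<bullet> x, {x. A' *v x \<le> b \<and> 0 \<le> P *v x \<and> x \<in> Fix G}))"

definition lp_Ret ::
  "real ^ 'n::{finite,linorder} ^ 'm \<Rightarrow> real ^ 'm \<Rightarrow> real ^ 'n::{finite,linorder} \<Rightarrow>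
   ('k \<Rightarrow> (real ^ 'n::{finite,linorder}) set) \<Rightarrow>
   (real ^ 'k::finite) lp" where
  "lp_Ret A b c Orb =
     (let P = orb_P Orb; c' = c v* P; A' = A ** P; M = orb_M Orb
      in (\<lambda>y. c' \<bullet> (M *v y), {y. (A' ** M) *v y \<le> b \<and> 0 \<le> y}))"

end

theory Submission imports Defs begin

text \<open>
  A vector is fixed by \<open>G\<close> iff it is constant on the orbits, and \<open>M\<^sub>r\<close> maps \<open>y\<close> to the vector with
  value \<open>y\<^sub>i\<close> on the \<open>i\<close>-th orbit. Hence \<open>M\<^sub>r\<close> is a bijection of \<open>\<real>\<^sup>k\<close> onto the fixed space. As \<open>P\<close> is
  the identity on the fixed space, \<open>M\<^sub>r\<close> maps the feasible points of the retracted program onto those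
  of \<open>Sub(\<Lambda>)\<close> and preserves the utility, hence it maps solutions onto solutions.
\<close>

lemma perm_act_axis: "perm_act g (axis i 1) = axis (g i) 1"
proof -
  have "perm_act g (axis i 1) = (\<Sum>j\<in>UNIV. if j = i then axis (g j) 1 else 0)"
    unfolding perm_act_def by (rule sum.cong) (auto simp: axis_def)
  then show ?thesis by simp
qed

text \<open>Injectivity of \<open>g\<close> leaves a single summand contributing to the coordinate
  \<open>g i\<close>.\<close>

lemma perm_act_nth:
  assumes "bij g"
  shows "perm_act g x $ g i = x $ i"
proof -
  have "perm_act g x $ g i = (\<Sum>j\<in>UNIV. if j = i then x $ j else 0)"
    unfolding perm_act_def sum_component
    using bij_is_inj[OF assms] by (intro sum.cong) (auto simp: axis_def inj_eq)
  then show ?thesis by simp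
qed

lemma perm_act_fixed_iff:
  assumes "bij g"
  shows "perm_act g x = x \<longleftrightarrow> (\<forall>i. x $ g i = x $ i)"
proof
  assume "perm_act g x = x"
  then show "\<forall>i. x $ g i = x $ i" using perm_act_nth[OF assms] by metis
next
  assume fixed: "\<forall>i. x $ g i = x $ i"
  show "perm_act g x = x"
    unfolding vec_eq_iff
  proof
    fix j
    obtain i where "j = g i" using bij_is_surj[OF assms] by (metis surjD)
    then show "perm_act g x $ j = x $ j" using perm_act_nth[OF assms] fixed by simp
  qed
qed

text \<open>The operations of \<open>BijGroup\<close> are restricted functions; over
  \<open>UNIV\<close> the restrictions vanish, leaving \<open>id\<close>, composition and
  inverse.\<close>

lemma subgroup_BijGroup_UNIV:
  assumes "subgroup G (BijGroup UNIV)"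
  shows "g \<in> G \<Longrightarrow> bij g"
    and "id \<in> G"
    and "g \<in> G \<Longrightarrow> h \<in> G \<Longrightarrow> g \<circ> h \<in> G"
    and "g \<in> G \<Longrightarrow> inv_into UNIV g \<in> G"
proof -
  have bij: "bij g" if "g \<in> G" for g
    using subgroup.mem_carrier[OF assms that] by (simp add: BijGroup_def Bij_def)
  have Bij: "g \<in> Bij UNIV" if "g \<in> G" for g
    using subgroup.mem_carrier[OF assms that] by (simp add: BijGroup_def)
  show "g \<in> G \<Longrightarrow> bij g" by (rule bij)
  show "id \<in> G"
    using subgroup.one_closed[OF assms] by (simp add: BijGroup_def restrict_UNIV id_def)
  show "g \<in> G \<Longrightarrow> h \<in> G \<Longrightarrow> g \<circ> h \<in> G"
    using subgroup.m_closed[OF assms, of g h] Bij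
    by (simp add: BijGroup_def compose_def restrict_UNIV comp_def)
  show "inv_into UNIV g \<in> G" if "g \<in> G"
    using subgroup.m_inv_closed[OF assms that] inv_BijGroup[OF Bij[OF that]]
    by (simp add: restrict_UNIV)
qed

lemma Fix_iff:
  assumes "subgroup G (BijGroup UNIV)"
  shows "x \<in> Fix G \<longleftrightarrow> (\<forall>g\<in>G. \<forall>i. x $ g i = x $ i)"
  unfolding Fix_def
  using perm_act_fixed_iff subgroup_BijGroup_UNIV(1)[OF assms] by blast

lemma basis_orbits_eq: "basis_orbits G = range (\<lambda>i. {axis (g i) 1 | g. g \<in> G})"
proof -
  have "basis_orbits G = (\<lambda>x. {perm_act g x | g. g \<in> G}) ` range (\<lambda>i. axis i 1)"
    unfolding basis_orbits_def orbits_def orbit_def by auto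
  then show ?thesis by (simp add: image_image perm_act_axis)
qed

text \<open>Orbits partition the basis, so each index \<open>j\<close> has a unique orbit number
  \<open>ind j\<close>. From here on \<open>ind\<close> replaces the group action in all coordinate
  computations.\<close>

lemma orbit_index_exists:
  fixes Orb :: "'k \<Rightarrow> (real ^ 'n::finite) set"
  assumes G: "subgroup G (BijGroup UNIV)"
    and Orb: "bij_betw Orb UNIV (basis_orbits G)"
  shows "\<exists>ind. surj ind \<and> (\<forall>j k. axis j 1 \<in> Orb k \<longleftrightarrow> ind j = k) \<and>
    (\<forall>i j. ind i = ind j \<longleftrightarrow> (\<exists>g\<in>G. g i = j))"
proof -
  note sub = subgroup_BijGroup_UNIV[OF G]
  \<comment> \<open>\<open>E i\<close> is the orbit of the basis vector with index \<open>i\<close>.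
    Identity, inverses and composition in \<open>G\<close> make these sets equivalence
    classes.\<close>
  define E where "E i = {axis (g i) 1 :: real ^ 'n | g. g \<in> G}" for i :: 'n
  have range_Orb: "range Orb = range E"
    using Orb unfolding bij_betw_def basis_orbits_eq E_def by simp
  have inj: "inj Orb" using Orb by (simp add: bij_betw_def)
  have in_E: "axis j 1 \<in> E i \<longleftrightarrow> (\<exists>g\<in>G. g i = j)" for i j
    unfolding E_def by (auto simp: axis_eq_axis)
  have refl: "\<exists>g\<in>G. g i = i" for i
    using sub(2) by (metis id_apply)
  have sym: "\<exists>g\<in>G. g j = i" if "\<exists>g\<in>G. g i = j" for i j
    using that sub(1,4) by (metis bij_inv_eq_iff)
  have trans: "\<exists>g\<in>G. g i = l" if "\<exists>g\<in>G. g i = j" "\<exists>g\<in>G. g j = l" for i j l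
    using that sub(3) by (metis comp_apply)
  have E_sub: "E j \<subseteq> E i" if j: "\<exists>g\<in>G. g i = j" for i j
  proof
    fix v assume "v \<in> E j"
    then obtain l where v: "v = axis l 1" and "\<exists>g\<in>G. g j = l" unfolding E_def by blast
    then show "v \<in> E i" using trans[OF j] in_E by blast
  qed
  have E_eq: "E i = E j \<longleftrightarrow> (\<exists>g\<in>G. g i = j)" for i j
    using E_sub sym in_E refl by (metis subset_antisym)
  \<comment> \<open>The description is proper: \<open>Orb\<close> is injective and hits every
    orbit.\<close>
  define ind where "ind j = (THE k. Orb k = E j)" for j
  have Orb_ind: "Orb (ind j) = E j" for j
  proof -
    obtain k where "Orb k = E j" using range_Orb by (metis rangeE rangeI)
    then show ?thesis unfolding ind_def using inj by (metis (mono_tags) injD theI)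
  qed
  have ind_eq: "ind j = k \<longleftrightarrow> Orb k = E j" for j k
    using Orb_ind inj by (metis injD)
  have "surj ind"
    using range_Orb ind_eq unfolding surj_def by (metis rangeE rangeI)
  moreover have "axis j 1 \<in> Orb k \<longleftrightarrow> ind j = k" for j k
  proof -
    obtain i where "Orb k = E i" using range_Orb by (metis rangeE rangeI)
    then show ?thesis using ind_eq E_eq in_E by metis
  qed
  moreover have "ind i = ind j \<longleftrightarrow> (\<exists>g\<in>G. g i = j)" for i j
    using ind_eq Orb_ind E_eq by metis
  ultimately show ?thesis by blast
qed

lemma orb_vec_nth:
  assumes "\<And>j k. axis j 1 \<in> Orb k \<longleftrightarrow> ind j = k"
  shows "orb_vec Orb k $ a = (if ind a = k then 1 else 0)"
  unfolding orb_vec_def sum_component assms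
  by (simp add: axis_def if_distrib sum.delta cong: if_cong)

text \<open>Row \<open>a\<close> of the matrix has a single 1, in column
  \<open>ind a\<close>.\<close>

lemma orb_M_mult_nth:
  fixes Orb :: "'k::finite \<Rightarrow> (real ^ 'n::finite) set"
  assumes "\<And>j k. axis j 1 \<in> Orb k \<longleftrightarrow> ind j = k"
  shows "(orb_M Orb *v y) $ a = y $ ind a"
  unfolding orb_M_def matrix_vector_mult_def
  by (simp add: orb_vec_nth[OF assms] if_distrib[where f = "\<lambda>t. t * _"] cong: if_cong)

text \<open>Surjectivity makes every orbit nonempty, so its minimum lies in it. Thus
  \<open>orb_rep Orb\<close> is a section of \<open>ind\<close>, and in particular
  injective.\<close>

lemma orb_rep_index:
  assumes "surj ind"
    and "\<And>j k. axis j 1 \<in> Orb k \<longleftrightarrow> ind j = k"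
  shows "ind (orb_rep Orb k) = k"
proof -
  have "{j. ind j = k} \<noteq> {}" using assms(1) by (metis (mono_tags) empty_iff mem_Collect_eq surjD)
  then have "Min {j. ind j = k} \<in> {j. ind j = k}" by (intro Min_in) auto
  then show ?thesis unfolding orb_rep_def assms(2) by simp
qed

text \<open>Row \<open>a\<close> of \<open>orb_P Orb\<close> has its only 1 at the representative of
  the orbit of \<open>a\<close>, so the matrix copies the value at each representative to its whole
  orbit.\<close>

lemma orb_P_mult_nth:
  fixes Orb :: "'k::finite \<Rightarrow> (real ^ 'n::{finite,linorder}) set"
  assumes "surj ind"
    and ind: "\<And>j k. axis j 1 \<in> Orb k \<longleftrightarrow> ind j = k"
  shows "(orb_P Orb *v x) $ a = x $ orb_rep Orb (ind a)"
proof -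
  note rep = orb_rep_index[OF assms]
  have inj: "inj (orb_rep Orb)" using rep by (metis injI)
  have "orb_P Orb $ a $ l = (if l = orb_rep Orb (ind a) then 1 else 0)" for l
  proof (cases "l \<in> range (orb_rep Orb)")
    case True
    then obtain k where "l = orb_rep Orb k" by blast
    then show ?thesis
      using inj by (auto simp: orb_P_def orb_vec_nth[OF ind] inj_eq)
  qed (auto simp: orb_P_def)
  then show ?thesis
    unfolding matrix_vector_mult_def
    by (simp add: if_distrib[where f = "\<lambda>t. t * _"] cong: if_cong)
qed

text \<open>Comparing utilities over the image of \<open>f\<close> amounts to comparing them over
  the feasible points of \<open>L\<close>.\<close>

lemma lp_solution_image:
  assumes feasible: "snd K = f ` snd L"
    and utility: "\<And>y. fst K (f y) = fst L y"
  shows "lp_solution K x \<longleftrightarrow> (\<exists>y. x = f y \<and> lp_solution L y)"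
  unfolding lp_solution_def feasible by (auto simp: utility)

theorem theorem7p12:
  fixes A :: "real ^ 'n::{finite,linorder} ^ 'm::finite"
    and b :: "real ^ 'm"
    and c :: "real ^ 'n::{finite,linorder}"
    and G :: "('n \<Rightarrow> 'n) set"
    and Orb :: "'k::finite \<Rightarrow> (real ^ 'n::{finite,linorder}) set"
  assumes "c \<noteq> 0"
    and "lp_symmetry_group A b c G"
    and "bij_betw Orb UNIV (basis_orbits G)"
    and "\<exists>x. lp_solution (lp_Sub A b c G Orb) x"
  shows "(\<exists>y. lp_solution (lp_Ret A b c Orb) y) \<and>
    (\<forall>y. lp_solution (lp_Ret A b c Orb) y \<longrightarrow>
          lp_solution (lp_Sub A b c G Orb) (orb_M Orb *v y))"
proof -
  have G: "subgroup G (BijGroup UNIV)"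
    using assms(2) by (simp add: lp_symmetry_group_def)
  obtain ind where surj: "surj ind" and ind: "\<And>j k. axis j 1 \<in> Orb k \<longleftrightarrow> ind j = k"
    and orbit: "\<And>i j. ind i = ind j \<longleftrightarrow> (\<exists>g\<in>G. g i = j)"
    using orbit_index_exists[OF G assms(3)] by auto
  note rep = orb_rep_index[OF surj ind]
  note M_nth = orb_M_mult_nth[OF ind]
  note P_nth = orb_P_mult_nth[OF surj ind]
  have Fix: "x \<in> Fix G \<longleftrightarrow> (\<forall>i j. ind i = ind j \<longrightarrow> x $ i = x $ j)" for x
    unfolding Fix_iff[OF G] orbit by metis
  have M_Fix: "orb_M Orb *v y \<in> Fix G" for y
    by (simp add: Fix M_nth)
  \<comment> \<open>The witness reads off \<open>x\<close> at the representatives; constancy on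
    orbits recovers the other coordinates.\<close>
  have Fix_M: "x = orb_M Orb *v (\<chi> k. x $ orb_rep Orb k)" if "x \<in> Fix G" for x
    unfolding vec_eq_iff M_nth vec_lambda_beta using that Fix rep by metis
  have PM: "orb_P Orb *v (orb_M Orb *v y) = orb_M Orb *v y" for y
    by (simp add: vec_eq_iff P_nth M_nth rep)
  \<comment> \<open>By surjectivity of \<open>ind\<close>, each coordinate of \<open>y\<close>
    occurs among those of the product.\<close>
  have nonneg: "0 \<le> orb_M Orb *v y \<longleftrightarrow> 0 \<le> y" for y
    using surj unfolding less_eq_vec_def M_nth by (metis surjD zero_index)
  have "snd (lp_Sub A b c G Orb) = (*v) (orb_M Orb) ` snd (lp_Ret A b c Orb)"
  proof (intro equalityI subsetI)
    fix x assume x: "x \<in> snd (lp_Sub A b c G Orb)"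
    then have "x \<in> Fix G" by (simp add: lp_Sub_def Let_def)
    then obtain y where y: "x = orb_M Orb *v y" using Fix_M by blast
    \<comment> \<open>By \<open>PM\<close> and \<open>nonneg\<close>, the sign condition on the
      image of \<open>x\<close> under \<open>orb_P Orb\<close> becomes
      \<open>0 \<le> y\<close>.\<close>
    then have "y \<in> snd (lp_Ret A b c Orb)"
      using x by (simp add: lp_Sub_def lp_Ret_def Let_def PM nonneg
          flip: matrix_vector_mul_assoc)
    with y show "x \<in> (*v) (orb_M Orb) ` snd (lp_Ret A b c Orb)" by blast
  next
    fix x assume "x \<in> (*v) (orb_M Orb) ` snd (lp_Ret A b c Orb)"
    then show "x \<in> snd (lp_Sub A b c G Orb)"
      by (auto simp: lp_Sub_def lp_Ret_def Let_def PM nonneg M_Fix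
          simp flip: matrix_vector_mul_assoc)
  qed
  moreover have "fst (lp_Sub A b c G Orb) (orb_M Orb *v y) = fst (lp_Ret A b c Orb) y" for y
    by (simp add: lp_Sub_def lp_Ret_def Let_def)
  ultimately have "lp_solution (lp_Sub A b c G Orb) x \<longleftrightarrow>
      (\<exists>y. x = orb_M Orb *v y \<and> lp_solution (lp_Ret A b c Orb) y)" for x
    by (rule lp_solution_image)
  \<comment> \<open>Left to right, the equivalence turns the given solution into one of the
    retracted program; right to left, it gives the second claim.\<close>
  then show ?thesis using assms(4) by blast
qed

end
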